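(* Let $\Omega\subset\mathbb{R}^2$ be the unit disk, let the background slowness field $m_0$ be positive and radial, $m_0(x)=m_0(|x|)$, and for a perturbation $\tilde m$ of the slowness field let $d_1(s,h)$ be the first-order approximation of the traveltime difference data, i.e. the line integral of $\tilde m$ along the background characteristic joining $x_s=(\cos s,\sin s)$ to $x_{s+h}=(\cos(s+h),\sin(s+h))$ (as defined in the context). Write $\tilde m(\theta,\rho)=\tilde m(\rho\cos\theta,\rho\sin\theta)$. Then there exists a function $\kappa(h,\rho,\cdot)$, periodic in the last parameter, such that for every perturbation $\tilde m$ and all angles $s,h$, $$d_1(s,h)=\int_0^1\int_0^{2\pi}\kappa(h,\rho,s-\theta)\,\tilde m(\theta,\rho)\,\mathrm{d}\theta\,\mathrm{d}\rho .$$
   Context: Setting: linearized first-arrival traveltime tomography in circular geometry. $\Omega$ is the unit disk in $\mathbb{R}^2$, and for an angle $s\in[0,2\pi)$ (angles are understood modulo $2\pi$) $x_s=(\cos s,\sin s)$ is the corresponding point of $\partial\Omega$. The background slowness field $m_0>0$ is known and depends only on $|x|$. For each source $x_s$, $u_0^s$ is the viscosity solution of the eikonal equation $|\nabla u_0^s(x)|=m_0(x)$, $x\in\Omega$, with $u_0^s(x_s)=0$ (condition imposed only at the point $x_s$). For $x_s,x_r\in\partial\Omega$, $\mathcal{C}_0(x_s,x_r)$ denotes the unique characteristic of $u_0^s$ that connects $x_s$ and $x_r$ (existence and uniqueness are assumed); for example, if $m_0$ is constant it is the line segment from $x_s$ to $x_r$. For a perturbation $\tilde m$ of the slowness field (so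 that the total slowness is $m_0+\tilde m$), linearizing the eikonal equation in $\tilde m$ gives the first-order approximation of the difference between the perturbed and background traveltimes from $x_s$ to $x_r$: $$d_1(x_s,x_r)=\int_{\mathcal{C}_0(x_s,x_r)}\tilde m(x)\,\mathrm{d}x,$$ where the integral is with respect to arclength along the curve. With the angular offset $h=r-s$ (modulo $2\pi$), one writes $d_1(s,h)=d_1(x_s,x_{s+h})$. Polar coordinates: $x=(\rho\cos\theta,\rho\sin\theta)$ with $\rho\in[0,1]$, $\theta\in[0,2\pi)$, and $\tilde m(\theta,\rho)=\tilde m(\rho\cos\theta,\rho\sin\theta)$. The linear dependence of $d_1$ on $\tilde m$ is expressed by a kernel distribution $K(s,h,\theta,\rho)$ with $$d_1(s,h)=\int_0^1\int_0^{2\pi}K(s,h,\theta,\rho)\,\tilde m(\theta,\rho)\,\mathrm{d}\theta\,\mathrm{d}\rho,$$ and the $\kappa$ of the claim is related to it by $K(s,h,\theta,\rho)=\kappa(h,\rho,s-\theta)$. *)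

theory Defs
  imports "HOL-Analysis.Analysis"
begin

section \<open>Eikonal equation in the unit disk\<close>

definition bdpt :: "real \<Rightarrow> real ^ 2" where
  "bdpt s = vector [cos s, sin s]"

definition polar :: "real \<Rightarrow> real \<Rightarrow> real ^ 2" where
  "polar \<rho> \<theta> = vector [\<rho> * cos \<theta>, \<rho> * sin \<theta>]"

definition C1_with_gradient ::
    "(real ^ 2) set \<Rightarrow> (real ^ 2 \<Rightarrow> real) \<Rightarrow> (real ^ 2 \<Rightarrow> real ^ 2) \<Rightarrow> bool" where
  "C1_with_gradient S \<phi> g \<longleftrightarrow>
     (\<forall>x\<in>S. (\<phi> has_derivative (\<lambda>v. g x \<bullet> v)) (at x)) \<and> continuous_on S g"

definition eikonal_subsolution :: "(real ^ 2 \<Rightarrow> real) \<Rightarrow> (real ^ 2 \<Rightarrow> real) \<Rightarrow> bool" where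
  "eikonal_subsolution m u \<longleftrightarrow>
     (\<forall>\<phi> g. \<forall>x \<in> ball 0 1. C1_with_gradient (ball 0 1) \<phi> g \<longrightarrow>
        (\<forall>\<^sub>F y in at x. u y - \<phi> y \<le> u x - \<phi> x) \<longrightarrow> norm (g x) \<le> m x)"

definition eikonal_supersolution :: "(real ^ 2 \<Rightarrow> real) \<Rightarrow> (real ^ 2 \<Rightarrow> real) \<Rightarrow> bool" where
  "eikonal_supersolution m u \<longleftrightarrow>
     (\<forall>\<phi> g. \<forall>x \<in> ball 0 1. C1_with_gradient (ball 0 1) \<phi> g \<longrightarrow>
        (\<forall>\<^sub>F y in at x. u y - \<phi> y \<ge> u x - \<phi> x) \<longrightarrow> norm (g x) \<ge> m x)"

definition point_source_viscosity_solution ::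
    "(real ^ 2 \<Rightarrow> real) \<Rightarrow> real ^ 2 \<Rightarrow> (real ^ 2 \<Rightarrow> real) \<Rightarrow> bool" where
  "point_source_viscosity_solution m a u \<longleftrightarrow>
     continuous_on (cball 0 1) u \<and> eikonal_subsolution m u \<and> eikonal_supersolution m u \<and> u a = 0"

text \<open>
  With a condition at the single boundary point \<open>a\<close> only, viscosity solutions are not unique:
  for \<open>m = 1\<close> and \<open>a = (1, 0)\<close> both \<open>x \<mapsto> norm (x - a)\<close> and \<open>x \<mapsto> x $ 1 - 1\<close> qualify.
  The solution meant in traveltime tomography is the first-arrival traveltime from \<open>a\<close>, which is
  the largest one.
\<close>

definition first_arrival ::
    "(real ^ 2 \<Rightarrow> real) \<Rightarrow> real ^ 2 \<Rightarrow> (real ^ 2 \<Rightarrow> real) \<Rightarrow> bool" where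
  "first_arrival m a u \<longleftrightarrow>
     point_source_viscosity_solution m a u \<and>
     (\<forall>v. point_source_viscosity_solution m a v \<longrightarrow> (\<forall>x \<in> cball 0 1. v x \<le> u x))"

section \<open>Characteristics and line integrals\<close>

text \<open>
  For the Hamiltonian \<open>H x p = norm p - m x\<close> a characteristic of \<open>u\<close> solves
  \<open>\<gamma>' = D\<^sub>p H = p / norm p\<close> with \<open>p\<close> the gradient of \<open>u\<close> at \<open>\<gamma> t\<close>; it is thus parametrised by
  arclength, and \<open>L\<close> is its length.  The gradient is taken relative to the closed disk, so that
  characteristics may touch the boundary.  The end points are exempt because \<open>u\<close> has a conical
  singularity at the source.  For \<open>a = b\<close> the constant curve with \<open>L = 0\<close> is allowed.
\<close>

definition characteristic ::
    "(real ^ 2 \<Rightarrow> real) \<Rightarrow> real ^ 2 \<Rightarrow> real ^ 2 \<Rightarrow> real \<Rightarrow> (real \<Rightarrow> real ^ 2) \<Rightarrow> bool" where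
  "characteristic u a b L \<gamma> \<longleftrightarrow>
     0 \<le> L \<and> continuous_on {0..L} \<gamma> \<and> \<gamma> ` {0..L} \<subseteq> cball 0 1 \<and> \<gamma> 0 = a \<and> \<gamma> L = b \<and>
     (\<forall>t \<in> {0<..<L}. \<exists>p. p \<noteq> 0 \<and>
        (u has_derivative (\<lambda>v. p \<bullet> v)) (at (\<gamma> t) within cball 0 1) \<and>
        (\<gamma> has_vector_derivative (p /\<^sub>R norm p)) (at t))"

definition unique_characteristic ::
    "(real ^ 2 \<Rightarrow> real) \<Rightarrow> real ^ 2 \<Rightarrow> real ^ 2 \<Rightarrow> real \<Rightarrow> (real \<Rightarrow> real ^ 2) \<Rightarrow> bool" where
  "unique_characteristic u a b L \<gamma> \<longleftrightarrow>
     characteristic u a b L \<gamma> \<and>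
     (\<forall>L' \<gamma>'. characteristic u a b L' \<gamma>' \<longrightarrow> L' = L \<and> (\<forall>t \<in> {0..L}. \<gamma>' t = \<gamma> t))"

definition arclength_integrable :: "real \<Rightarrow> (real \<Rightarrow> real ^ 2) \<Rightarrow> (real ^ 2 \<Rightarrow> real) \<Rightarrow> bool" where
  "arclength_integrable L \<gamma> f \<longleftrightarrow> set_integrable lborel {0..L} (\<lambda>t. f (\<gamma> t))"

definition arclength_integral :: "real \<Rightarrow> (real \<Rightarrow> real ^ 2) \<Rightarrow> (real ^ 2 \<Rightarrow> real) \<Rightarrow> real" where
  "arclength_integral L \<gamma> f = (LINT t:{0..L}|lborel. f (\<gamma> t))"

section \<open>Periodic kernels\<close>

text \<open>
  The kernel of a line integral is a delta distribution carried by the curve, not a function.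
  A kernel \<open>k(\<rho>, \<phi>)\<close> is represented by the Radon measure \<open>k(\<rho>, \<phi>) d\<rho> d\<phi>\<close> (a distribution of
  order zero) on the plane of pairs \<open>(\<rho>, \<phi>)\<close>, carried by \<open>0 \<le> \<rho> \<le> 1\<close> and invariant under
  \<open>\<phi> \<mapsto> \<phi> + 2\<pi>\<close>.
\<close>

definition periodic_kernel :: "(real \<times> real) measure \<Rightarrow> bool" where
  "periodic_kernel k \<longleftrightarrow>
     sets k = sets borel \<and>
     (\<forall>C. compact C \<longrightarrow> emeasure k C < \<infinity>) \<and>
     emeasure k (- ({0..1} \<times> UNIV)) = 0 \<and>
     distr k borel (\<lambda>(\<rho>, \<phi>). (\<rho>, \<phi> + 2 * pi)) = k"

text \<open>
  The kernel \<open>(\<rho>, \<theta>) \<mapsto> k(\<rho>, s - \<theta>)\<close>: the substitution \<open>\<phi> = s - \<theta>\<close> is the image measure under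
  \<open>\<phi> \<mapsto> s - \<phi>\<close>, which is its own inverse and has Jacobian of modulus one.
\<close>

definition shift_kernel :: "real \<Rightarrow> (real \<times> real) measure \<Rightarrow> (real \<times> real) measure" where
  "shift_kernel s k = distr k borel (\<lambda>(\<rho>, \<phi>). (\<rho>, s - \<phi>))"

text \<open>
  The integral of \<open>K(\<rho>, \<theta>) f(\<rho> cos \<theta>, \<rho> sin \<theta>)\<close> over \<open>0 \<le> \<rho> \<le> 1\<close>, \<open>0 \<le> \<theta> < 2\<pi>\<close>, with the
  density \<open>K(\<rho>, \<theta>) d\<theta> d\<rho>\<close> given as a measure.  No polar area factor \<open>\<rho>\<close> appears.
\<close>

definition kernel_integrable :: "(real \<times> real) measure \<Rightarrow> (real ^ 2 \<Rightarrow> real) \<Rightarrow> bool" where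
  "kernel_integrable K f \<longleftrightarrow>
     set_integrable K ({0..1} \<times> {0..<2 * pi}) (\<lambda>(\<rho>, \<theta>). f (polar \<rho> \<theta>))"

definition kernel_integral :: "(real \<times> real) measure \<Rightarrow> (real ^ 2 \<Rightarrow> real) \<Rightarrow> real" where
  "kernel_integral K f =
     set_lebesgue_integral K ({0..1} \<times> {0..<2 * pi}) (\<lambda>(\<rho>, \<theta>). f (polar \<rho> \<theta>))"

end

theory Submission imports Defs begin

text \<open>
  The background is rotationally symmetric, hence so are its characteristics.  If \<open>T\<close> is the
  rotation by \<open>s\<close>, composition with \<open>T\<close> maps the viscosity solutions with source \<open>T a\<close> to those with
  source \<open>a\<close>, because the eikonal equation is invariant under orthogonal transformations and
  \<open>m\<^sub>0 \<circ> T = m\<^sub>0\<close>.  It preserves the pointwise order, so it maps the first arrival from \<open>T a\<close> to the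
  first arrival from \<open>a\<close> (\<open>first_arrival_compose_orthogonal\<close>); the latter is unique, being the
  largest solution.  So \<open>T\<close> carries the characteristic from \<open>bdpt 0\<close> to \<open>bdpt h\<close> to a
  characteristic from \<open>bdpt s\<close> to \<open>bdpt (s + h)\<close> (\<open>characteristic_image_orthogonal\<close>), and by
  uniqueness this is the curve along which \<open>d\<^sub>1(s, h)\<close> integrates.

  It remains to write the line integral along the rotated copies of one curve \<open>\<gamma>\<close> as an integral
  against one kernel.  Formally the kernel is
  \<open>\<kappa>(\<rho>, \<phi>) = \<integral> \<delta>(\<rho> - |\<gamma> t|) \<Sum>\<^sub>k \<delta>(\<phi> + arg (\<gamma> t) - 2\<pi>k) dt\<close>: it is carried by the curve, with
  its polar angle reflected because \<open>\<kappa>\<close> is evaluated at \<open>s - \<theta>\<close>, and repeated with period \<open>2\<pi>\<close>.  As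
  a measure it is the image of arclength times counting measure on the integers
  (\<open>curve_kernel\<close>).  After the substitution \<open>\<theta> = s - \<phi>\<close> the point \<open>(t, k)\<close> sits at the polar
  coordinates \<open>|\<gamma> t|\<close> and \<open>s + arg (\<gamma> t) - 2\<pi>k\<close> of the rotated curve point, and for each \<open>t\<close> exactly
  one \<open>k\<close> puts this angle into \<open>[0, 2\<pi>)\<close>.  Fubini's theorem then gives back the line integral
  (\<open>curve_kernel_integral\<close>).
\<close>

section \<open>Orthogonal transformations and the eikonal equation\<close>

lemma orthogonal_transformation_inv_simps:
  fixes T :: "'a::euclidean_space \<Rightarrow> 'a"
  assumes T: "orthogonal_transformation T"
  shows "T (inv T x) = x" "inv T (T x) = x" "inv T x \<bullet> y = x \<bullet> T y" "x \<bullet> inv T y = T x \<bullet> y"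
    "norm (T x) = norm x" "norm (inv T x) = norm x"
    "T (c *\<^sub>R x) = c *\<^sub>R T x" "bounded_linear T" "bounded_linear (inv T)"
proof -
  have bij: "bij T"
    using T by (rule orthogonal_transformation_bij)
  show 1: "T (inv T y) = y" for y
    using bij by (simp add: bij_is_surj surj_f_inv_f)
  show "inv T (T x) = x"
    using bij by (simp add: bij_is_inj)
  have T': "orthogonal_transformation (inv T)"
    using T by (rule orthogonal_transformation_inv)
  show "inv T x \<bullet> y = x \<bullet> T y" "x \<bullet> inv T y = T x \<bullet> y"
    using 1 T by (metis orthogonal_transformation_def)+
  show "norm (T x) = norm x" "norm (inv T x) = norm x"
    using T T' by (simp_all add: orthogonal_transformation_norm)
  show "T (c *\<^sub>R x) = c *\<^sub>R T x"
    using T by (rule orthogonal_transformation_scaleR)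
  show "bounded_linear T" "bounded_linear (inv T)"
    using T T' by (auto simp: orthogonal_transformation_def linear_conv_bounded_linear)
qed

lemma C1_with_gradient_compose_orthogonal:
  assumes T: "orthogonal_transformation T" and \<phi>: "C1_with_gradient (ball 0 r) \<phi> g"
  shows "C1_with_gradient (ball 0 r) (\<lambda>x. \<phi> (T x)) (\<lambda>x. inv T (g (T x)))"
  unfolding C1_with_gradient_def
proof (intro conjI ballI)
  note [simp] = orthogonal_transformation_inv_simps[OF T]
  fix x :: "real ^ 2"
  assume "x \<in> ball 0 r"
  then have "(\<phi> has_derivative (\<lambda>v. g (T x) \<bullet> v)) (at (T x))"
    using \<phi> by (simp add: C1_with_gradient_def)
  from has_derivative_compose[OF bounded_linear_imp_has_derivative[OF orthogonal_transformation_inv_simps(8)[OF T]] this]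
  show "((\<lambda>x. \<phi> (T x)) has_derivative (\<lambda>v. inv T (g (T x)) \<bullet> v)) (at x)"
    by simp
next
  note [simp] = orthogonal_transformation_inv_simps[OF T]
  have "continuous_on (ball 0 r) g"
    using \<phi> by (simp add: C1_with_gradient_def)
  then have "continuous_on (ball 0 r) (\<lambda>x. g (T x))"
    by (rule continuous_on_compose2) (auto simp: linear_continuous_on)
  then show "continuous_on (ball 0 r) (\<lambda>x. inv T (g (T x)))"
    by (rule bounded_linear.continuous_on[rotated]) simp
qed

text \<open>
  This transports the local comparison of a solution with a test function at \<open>x\<close> to \<open>T x\<close>.
\<close>

lemma eventually_at_orthogonal:
  fixes T :: "'a::euclidean_space \<Rightarrow> 'a"
  assumes T: "orthogonal_transformation T" and P: "\<forall>\<^sub>F y in at x. P y"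
  shows "\<forall>\<^sub>F y in at (T x). P (inv T y)"
proof -
  note [simp] = orthogonal_transformation_inv_simps[OF T]
  have "((\<lambda>y. inv T y) \<longlongrightarrow> inv T (T x)) (at (T x))"
    by (rule bounded_linear.tendsto[OF _ tendsto_ident_at]) simp
  moreover have "\<forall>\<^sub>F y in at (T x). inv T y \<noteq> x"
    unfolding eventually_at_filter by (rule always_eventually) (metis orthogonal_transformation_inv_simps(1)[OF T])
  ultimately have "filterlim (inv T) (at x) (at (T x))"
    by (simp add: filterlim_at)
  then show ?thesis
    using P by (rule eventually_compose_filterlim[rotated])
qed

text \<open>
  A test function \<open>\<phi>\<close> touches \<open>u \<circ> T\<close> at \<open>x\<close> if and only if \<open>\<phi> \<circ> T\<inverse>\<close> touches \<open>u\<close> at \<open>T x\<close>, from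
  the same side, and \<open>T\<close> preserves the length of the gradient.
\<close>

lemma point_source_viscosity_solution_compose_orthogonal:
  assumes T: "orthogonal_transformation T"
    and m: "\<And>x. x \<in> ball 0 1 \<Longrightarrow> m (T x) = m x"
    and u: "point_source_viscosity_solution m (T a) u"
  shows "point_source_viscosity_solution m a (\<lambda>x. u (T x))"
proof -
  note [simp] = orthogonal_transformation_inv_simps[OF T]
  have T': "orthogonal_transformation (inv T)"
    using T by (rule orthogonal_transformation_inv)
  have [simp]: "inv (inv T) = T"
    using T by (simp add: inv_inv_eq orthogonal_transformation_bij)
  have "continuous_on (cball 0 1) (\<lambda>x. u (T x))"
    by (rule continuous_on_compose2[of "cball 0 1" u])
      (use u in \<open>auto simp: point_source_viscosity_solution_def linear_continuous_on\<close>)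
  moreover have "eikonal_subsolution m (\<lambda>x. u (T x))"
    unfolding eikonal_subsolution_def
  proof (intro allI ballI impI)
    fix \<phi> g and x :: "real ^ 2"
    assume x: "x \<in> ball 0 1" and \<phi>: "C1_with_gradient (ball 0 1) \<phi> g"
      and "\<forall>\<^sub>F y in at x. u (T y) - \<phi> y \<le> u (T x) - \<phi> x"
    from eventually_at_orthogonal[OF T this(3)]
    have ev: "\<forall>\<^sub>F y in at (T x). u y - \<phi> (inv T y) \<le> u (T x) - \<phi> (inv T (T x))"
      by simp
    have sol: "eikonal_subsolution m u" and Tx: "T x \<in> ball 0 1"
      using u x by (simp_all add: point_source_viscosity_solution_def)
    have "norm (inv (inv T) (g (inv T (T x)))) \<le> m (T x)"
      by (rule sol[unfolded eikonal_subsolution_def, rule_format, OF Tx C1_with_gradient_compose_orthogonal[OF T' \<phi>] ev])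
    then show "norm (g x) \<le> m x"
      using m[OF x] by simp
  qed
  moreover have "eikonal_supersolution m (\<lambda>x. u (T x))"
    unfolding eikonal_supersolution_def
  proof (intro allI ballI impI)
    fix \<phi> g and x :: "real ^ 2"
    assume x: "x \<in> ball 0 1" and \<phi>: "C1_with_gradient (ball 0 1) \<phi> g"
      and "\<forall>\<^sub>F y in at x. u (T y) - \<phi> y \<ge> u (T x) - \<phi> x"
    from eventually_at_orthogonal[OF T this(3)]
    have ev: "\<forall>\<^sub>F y in at (T x). u y - \<phi> (inv T y) \<ge> u (T x) - \<phi> (inv T (T x))"
      by simp
    have sol: "eikonal_supersolution m u" and Tx: "T x \<in> ball 0 1"
      using u x by (simp_all add: point_source_viscosity_solution_def)
    have "norm (inv (inv T) (g (inv T (T x)))) \<ge> m (T x)"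
      by (rule sol[unfolded eikonal_supersolution_def, rule_format, OF Tx C1_with_gradient_compose_orthogonal[OF T' \<phi>] ev])
    then show "norm (g x) \<ge> m x"
      using m[OF x] by simp
  qed
  moreover have "u (T a) = 0"
    using u unfolding point_source_viscosity_solution_def by blast
  ultimately show ?thesis
    unfolding point_source_viscosity_solution_def by blast
qed

text \<open>
  A competitor \<open>v\<close> with source \<open>a\<close> yields the competitor \<open>v \<circ> T\<inverse>\<close> with source \<open>T a\<close>, which lies
  below \<open>u\<close>; so maximality is inherited.
\<close>

lemma first_arrival_compose_orthogonal:
  assumes T: "orthogonal_transformation T"
    and m: "\<And>x. x \<in> ball 0 1 \<Longrightarrow> m (T x) = m x"
    and u: "first_arrival m (T a) u"
  shows "first_arrival m a (\<lambda>x. u (T x))"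
  unfolding first_arrival_def
proof (intro conjI allI impI ballI)
  note [simp] = orthogonal_transformation_inv_simps[OF T]
  have T': "orthogonal_transformation (inv T)"
    using T by (rule orthogonal_transformation_inv)
  show "point_source_viscosity_solution m a (\<lambda>x. u (T x))"
  proof (rule point_source_viscosity_solution_compose_orthogonal[OF T])
    show "m (T x) = m x" if "x \<in> ball 0 1" for x
      using that by (rule m)
    show "point_source_viscosity_solution m (T a) u"
      using u unfolding first_arrival_def by (rule conjunct1)
  qed
  fix v and x :: "real ^ 2"
  assume v: "point_source_viscosity_solution m a v" and x: "x \<in> cball 0 1"
  have rotated: "point_source_viscosity_solution m (T a) (\<lambda>y. v (inv T y))"
  proof (rule point_source_viscosity_solution_compose_orthogonal[OF T'])
    show "m (inv T y) = m y" if "y \<in> ball 0 1" for y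
      using m[of "inv T y"] that by simp
    show "point_source_viscosity_solution m (inv T (T a)) v"
      using v by simp
  qed
  have "T x \<in> cball 0 1"
    using x by simp
  with u[unfolded first_arrival_def, THEN conjunct2, rule_format, OF rotated]
  have "v (inv T (T x)) \<le> u (T x)"
    .
  then show "v x \<le> u (T x)"
    by simp
qed

lemma first_arrival_unique:
  assumes "first_arrival m a u" "first_arrival m a v" "x \<in> cball 0 1"
  shows "u x = v x"
  using assms by (meson first_arrival_def order_antisym)

text \<open>
  If \<open>p\<close> is the gradient of \<open>u\<close> at \<open>\<gamma> t\<close>, then \<open>T p\<close> is the gradient of \<open>v = u \<circ> T\<inverse>\<close> at \<open>T (\<gamma> t)\<close>,
  and \<open>T\<close> maps the unit direction of \<open>p\<close> to that of \<open>T p\<close>.  Agreement of \<open>v \<circ> T\<close> and \<open>u\<close> on the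
  closed disk suffices, since gradients are relative to it.
\<close>

lemma characteristic_image_orthogonal:
  assumes T: "orthogonal_transformation T"
    and uv: "\<And>x. x \<in> cball 0 1 \<Longrightarrow> v (T x) = u x"
    and \<gamma>: "characteristic u a b L \<gamma>"
  shows "characteristic v (T a) (T b) L (\<lambda>t. T (\<gamma> t))"
  unfolding characteristic_def
proof (intro conjI ballI)
  note [simp] = orthogonal_transformation_inv_simps[OF T]
  have lin: "bounded_linear T" "bounded_linear (inv T)"
    by simp_all
  have range: "\<gamma> ` {0..L} \<subseteq> cball 0 1"
    using \<gamma> by (simp add: characteristic_def)
  show "0 \<le> L" "T (\<gamma> 0) = T a" "T (\<gamma> L) = T b"
    using \<gamma> by (auto simp: characteristic_def)
  show "continuous_on {0..L} (\<lambda>t. T (\<gamma> t))"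
    using \<gamma> by (intro bounded_linear.continuous_on[OF lin(1)]) (simp add: characteristic_def)
  show "(\<lambda>t. T (\<gamma> t)) ` {0..L} \<subseteq> cball 0 1"
    using range by auto
  fix t
  assume t: "t \<in> {0<..<L}"
  then obtain p where p: "p \<noteq> 0"
    "(u has_derivative (\<lambda>v. p \<bullet> v)) (at (\<gamma> t) within cball 0 1)"
    "(\<gamma> has_vector_derivative (p /\<^sub>R norm p)) (at t)"
    using \<gamma> unfolding characteristic_def by blast
  have \<gamma>t: "\<gamma> t \<in> cball 0 1"
    using t range by (simp add: image_subset_iff)
  have im: "inv T ` cball 0 1 = cball 0 1"
    by (auto intro!: image_eqI[of _ "inv T" "T _"])
  have "((\<lambda>x. u (inv T x)) has_derivative (\<lambda>w. p \<bullet> inv T w)) (at (T (\<gamma> t)) within cball 0 1)"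
    by (rule has_derivative_in_compose[OF bounded_linear_imp_has_derivative[OF lin(2)]])
      (use p im in simp)
  moreover have "v x = u (inv T x)" if "x \<in> cball 0 1" for x
    using uv[of "inv T x"] that by simp
  ultimately have "(v has_derivative (\<lambda>w. p \<bullet> inv T w)) (at (T (\<gamma> t)) within cball 0 1)"
    using \<gamma>t by (intro has_derivative_transform[of _ _ v]) auto
  moreover have "T p \<noteq> 0"
    using p(1) by (metis norm_eq_zero orthogonal_transformation_inv_simps(5)[OF T])
  moreover have "((\<lambda>t. T (\<gamma> t)) has_vector_derivative (T p /\<^sub>R norm (T p))) (at t)"
    using bounded_linear.has_vector_derivative[OF lin(1) p(3)] by simp
  ultimately show "\<exists>p. p \<noteq> 0 \<and>
      (v has_derivative (\<lambda>w. p \<bullet> w)) (at (T (\<gamma> t)) within cball 0 1) \<and>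
      ((\<lambda>t. T (\<gamma> t)) has_vector_derivative (p /\<^sub>R norm p)) (at t)"
    by (intro exI[of _ "T p"]) simp
qed

section \<open>Rotations and polar coordinates\<close>

definition rotation :: "real \<Rightarrow> real ^ 2 \<Rightarrow> real ^ 2" where
  "rotation s x = vector [cos s * x $ 1 - sin s * x $ 2, sin s * x $ 1 + cos s * x $ 2]"

lemma orthogonal_transformation_rotation: "orthogonal_transformation (rotation s)"
  unfolding orthogonal_transformation_def
proof (intro conjI allI)
  show "linear (rotation s)"
    by (intro linearI) (simp_all add: rotation_def vec_eq_iff forall_2 algebra_simps)
  fix v w
  have "rotation s v \<bullet> rotation s w = ((sin s)\<^sup>2 + (cos s)\<^sup>2) * (v \<bullet> w)"
    unfolding rotation_def inner_vec_def sum_2 vector_2 inner_real_def by algebra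
  then show "rotation s v \<bullet> rotation s w = v \<bullet> w"
    by simp
qed

lemma rotation_bdpt: "rotation s (bdpt h) = bdpt (s + h)"
  by (simp add: rotation_def bdpt_def vec_eq_iff forall_2 cos_add sin_add)

lemma rotation_polar: "rotation s (polar \<rho> \<theta>) = polar \<rho> (s + \<theta>)"
  by (simp add: rotation_def polar_def vec_eq_iff forall_2 cos_add sin_add algebra_simps)

lemma norm_polar: "norm (polar \<rho> \<theta>) = \<bar>\<rho>\<bar>"
proof -
  have "(norm (polar \<rho> \<theta>))\<^sup>2 = \<rho>\<^sup>2 * ((sin \<theta>)\<^sup>2 + (cos \<theta>)\<^sup>2)"
    unfolding power2_norm_eq_inner polar_def inner_vec_def sum_2 vector_2 inner_real_def by algebra
  then show ?thesis
    by (metis mult.right_neutral norm_ge_zero real_sqrt_abs real_sqrt_unique sin_cos_squared_add)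
qed

lemma polar_minus_period: "polar \<rho> (\<theta> - 2 * pi * of_int k) = polar \<rho> \<theta>"
  by (simp add: polar_def cos_diff sin_diff)

lemma borel_measurable_polar [measurable]:
  "(\<lambda>z :: real \<times> real. polar (fst z) (snd z)) \<in> borel_measurable borel"
proof (rule borel_measurable_continuous_onI)
  have "polar (fst z) (snd z) =
      (\<chi> i. if i = 1 then fst z * cos (snd z) else fst z * sin (snd z))" for z
    by (simp add: polar_def vec_eq_iff forall_2)
  moreover have "continuous_on UNIV
      (\<lambda>z :: real \<times> real. if i = 1 then fst z * cos (snd z) else fst z * sin (snd z))" for i :: 2
    by (cases "i = 1") (auto intro!: continuous_intros)
  ultimately show "continuous_on UNIV (\<lambda>z :: real \<times> real. polar (fst z) (snd z))"
    by (simp add: continuous_on_vec_lambda)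
qed

definition angle :: "real ^ 2 \<Rightarrow> real" where
  "angle x = Arg (Complex (x $ 1) (x $ 2))"

lemma polar_angle: "polar (norm x) (angle x) = x"
proof -
  have "cmod (Complex (x $ 1) (x $ 2)) = norm x"
    by (simp add: cmod_def norm_vec_def L2_set_def sum_2)
  then show ?thesis
    using rcis_cmod_Arg[of "Complex (x $ 1) (x $ 2)"]
    by (simp add: polar_def angle_def vec_eq_iff forall_2 complex_eq_iff)
qed

lemma angle_bounded: "- pi < angle x" "angle x \<le> pi"
  unfolding angle_def using Arg_bounded by auto

lemma borel_measurable_Arg: "Arg \<in> borel_measurable borel"
proof -
  (* Arg is continuous off the closed negative real axis and takes just the values 0 and pi on it. *)
  have eq: "Arg = (\<lambda>z. if z \<in> - \<real>\<^sub>\<le>\<^sub>0 then Arg z else if z \<in> {0} then 0 else pi)"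
  proof
    fix z :: complex
    have "Arg z = pi" if "z \<in> \<real>\<^sub>\<le>\<^sub>0" "z \<noteq> 0"
      using that by (auto simp: Arg_eq_pi complex_nonpos_Reals_iff complex_eq_iff)
    then show "Arg z = (if z \<in> - \<real>\<^sub>\<le>\<^sub>0 then Arg z else if z \<in> {0} then 0 else pi)"
      by (auto simp: Arg_zero)
  qed
  have 1: "Arg \<in> borel_measurable (restrict_space borel (- \<real>\<^sub>\<le>\<^sub>0))"
    by (intro borel_measurable_continuous_on_restrict continuous_on_Arg)
  have "(\<lambda>z. if z \<in> - \<real>\<^sub>\<le>\<^sub>0 then Arg z else if z \<in> {0} then 0 else pi) \<in> borel_measurable borel"
  proof (subst measurable_If_restrict_space_iff)
    have "- \<real>\<^sub>\<le>\<^sub>0 \<in> sets (borel :: complex measure)"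
      by (intro borel_open) auto
    then show "{x \<in> space borel. x \<in> - \<real>\<^sub>\<le>\<^sub>0} \<in> sets (borel :: complex measure)"
      by (simp add: Compl_eq)
    have "(\<lambda>z. if z \<in> {0} then 0 else pi) \<in> borel_measurable (borel :: complex measure)"
      by measurable
    then have "(\<lambda>z. if z \<in> {0} then 0 else pi) \<in>
        borel_measurable (restrict_space borel {z :: complex. z \<notin> - \<real>\<^sub>\<le>\<^sub>0})"
      by (rule measurable_restrict_space1)
    with 1 show "Arg \<in> borel_measurable (restrict_space borel {z. z \<in> - \<real>\<^sub>\<le>\<^sub>0}) \<and>
        (\<lambda>z. if z \<in> {0} then 0 else pi) \<in>
          borel_measurable (restrict_space borel {z :: complex. z \<notin> - \<real>\<^sub>\<le>\<^sub>0})"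
      by (simp add: Compl_eq)
  qed
  then show ?thesis
    by (subst eq)
qed

lemma borel_measurable_angle [measurable]: "angle \<in> borel_measurable borel"
proof -
  have "continuous_on UNIV (\<lambda>x :: real ^ 2. Complex (x $ 1) (x $ 2))"
    unfolding Complex_eq by (intro continuous_intros)
  then have "(\<lambda>x :: real ^ 2. Complex (x $ 1) (x $ 2)) \<in> borel_measurable borel"
    by (rule borel_measurable_continuous_onI)
  from measurable_compose[OF this borel_measurable_Arg] show ?thesis
    by (simp add: angle_def[abs_def])
qed

section \<open>The kernel of a curve\<close>

text \<open>
  The factor \<open>count_space UNIV\<close> enumerates the periods.  The angle enters with a minus sign because
  the kernel is evaluated at \<open>\<phi> = s - \<theta>\<close>, which is \<open>- \<theta>\<close> for the source angle \<open>s = 0\<close>.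
\<close>

definition curve_kernel :: "real \<Rightarrow> (real \<Rightarrow> real ^ 2) \<Rightarrow> (real \<times> real) measure" where
  "curve_kernel L \<gamma> = distr (restrict_space lborel {0..L} \<Otimes>\<^sub>M count_space UNIV) borel
     (\<lambda>(t, k :: int). (norm (\<gamma> t), 2 * pi * of_int k - angle (\<gamma> t)))"

lemma sigma_finite_restrict_lborel: "sigma_finite_measure (restrict_space lborel {0..L :: real})"
  by (intro sigma_finite_measure_restrict_space sigma_finite_lborel) auto

lemma measurable_curve:
  fixes \<gamma> :: "real \<Rightarrow> real ^ 2"
  assumes "continuous_on {0..L} \<gamma>"
  shows "\<gamma> \<in> borel_measurable (restrict_space lborel {0..L})"
  using borel_measurable_continuous_on_restrict[OF assms]
  by (simp add: measurable_def space_restrict_space sets_restrict_space)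

lemma measurable_curve_kernel_map:
  fixes \<gamma> :: "real \<Rightarrow> real ^ 2"
  assumes "continuous_on {0..L} \<gamma>"
  shows "(\<lambda>(t, k :: int). (norm (\<gamma> t), 2 * pi * of_int k - angle (\<gamma> t)))
    \<in> restrict_space lborel {0..L} \<Otimes>\<^sub>M count_space UNIV \<rightarrow>\<^sub>M borel"
proof -
  note [measurable] = measurable_curve[OF assms]
  show ?thesis
    unfolding borel_prod[symmetric] by measurable
qed

text \<open>
  Shifting \<open>\<phi>\<close> by a period amounts to the substitution \<open>k \<mapsto> k + 1\<close>, under which counting measure
  is invariant.
\<close>

lemma distr_shift_curve_kernel:
  assumes \<gamma>: "continuous_on {0..L} \<gamma>"
  shows "distr (curve_kernel L \<gamma>) borel (\<lambda>(\<rho>, \<phi>). (\<rho>, \<phi> + 2 * pi)) = curve_kernel L \<gamma>"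
proof -
  let ?M = "restrict_space lborel {0..L} :: real measure"
  let ?N = "count_space UNIV :: int measure"
  let ?f = "\<lambda>(t, k :: int). (norm (\<gamma> t), 2 * pi * of_int k - angle (\<gamma> t))"
  note f [measurable] = measurable_curve_kernel_map[OF \<gamma>]
  have shift: "(\<lambda>(\<rho>, \<phi>). (\<rho>, \<phi> + 2 * pi)) \<in> (borel :: (real \<times> real) measure) \<rightarrow>\<^sub>M borel"
    unfolding borel_prod[symmetric] by measurable
  have N: "distr ?N ?N (\<lambda>k. k + 1) = ?N"
    by (rule distr_bij_count_space) (rule bij_betw_byWitness[of _ "\<lambda>k. k - 1"], auto)
  have "?M \<Otimes>\<^sub>M ?N = distr ?M ?M (\<lambda>t. t) \<Otimes>\<^sub>M distr ?N ?N (\<lambda>k. k + 1)"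
    unfolding N by (simp add: distr_id)
  also have "\<dots> = distr (?M \<Otimes>\<^sub>M ?N) (?M \<Otimes>\<^sub>M ?N) (\<lambda>(t, k). (t, k + 1))"
    by (rule pair_measure_distr) (simp_all add: N sigma_finite_measure_count_space)
  finally have P: "distr (?M \<Otimes>\<^sub>M ?N) (?M \<Otimes>\<^sub>M ?N) (\<lambda>(t, k). (t, k + 1)) = ?M \<Otimes>\<^sub>M ?N" ..
  have "distr (curve_kernel L \<gamma>) borel (\<lambda>(\<rho>, \<phi>). (\<rho>, \<phi> + 2 * pi)) =
      distr (?M \<Otimes>\<^sub>M ?N) borel ((\<lambda>(\<rho>, \<phi>). (\<rho>, \<phi> + 2 * pi)) \<circ> ?f)"
    unfolding curve_kernel_def by (rule distr_distr[OF shift f])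
  also have "(\<lambda>(\<rho>, \<phi>). (\<rho>, \<phi> + 2 * pi)) \<circ> ?f = ?f \<circ> (\<lambda>(t, k). (t, k + 1))"
    by (auto simp: fun_eq_iff algebra_simps)
  also have "distr (?M \<Otimes>\<^sub>M ?N) borel (?f \<circ> (\<lambda>(t, k). (t, k + 1))) =
      distr (distr (?M \<Otimes>\<^sub>M ?N) (?M \<Otimes>\<^sub>M ?N) (\<lambda>(t, k). (t, k + 1))) borel ?f"
    by (rule distr_distr[OF f, symmetric]) measurable
  finally show ?thesis
    unfolding P by (simp add: curve_kernel_def)
qed

text \<open>
  The kernel is a Radon measure because \<open>angle\<close> is bounded: a compact set meets only finitely many
  of the periods, and each of them carries the length of \<open>{0..L}\<close>.
\<close>

lemma periodic_kernel_curve_kernel: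
  assumes \<gamma>: "continuous_on {0..L} \<gamma>" and range: "\<gamma> ` {0..L} \<subseteq> cball 0 1"
  shows "periodic_kernel (curve_kernel L \<gamma>)"
  unfolding periodic_kernel_def
proof (intro conjI allI impI)
  let ?M = "restrict_space lborel {0..L} :: real measure"
  let ?N = "count_space UNIV :: int measure"
  let ?f = "\<lambda>(t, k :: int). (norm (\<gamma> t), 2 * pi * of_int k - angle (\<gamma> t))"
  note f [measurable] = measurable_curve_kernel_map[OF \<gamma>]
  interpret N: sigma_finite_measure ?N
    by (rule sigma_finite_measure_count_space)
  show "sets (curve_kernel L \<gamma>) = sets borel"
    by (simp add: curve_kernel_def)
  show "distr (curve_kernel L \<gamma>) borel (\<lambda>(\<rho>, \<phi>). (\<rho>, \<phi> + 2 * pi)) = curve_kernel L \<gamma>"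
    using \<gamma> by (rule distr_shift_curve_kernel)
  have strip: "- ({0..1} \<times> UNIV) \<in> sets (borel :: (real \<times> real) measure)"
    by (intro borel_open open_Compl closed_Times) auto
  have "?f -` (- ({0..1} \<times> UNIV)) \<inter> space (?M \<Otimes>\<^sub>M ?N) = {}"
    using range by (auto simp: space_pair_measure space_restrict_space image_subset_iff)
  then show "emeasure (curve_kernel L \<gamma>) (- ({0..1} \<times> UNIV)) = 0"
    unfolding curve_kernel_def by (simp only: emeasure_distr[OF f strip] emeasure_empty)
  fix C :: "(real \<times> real) set"
  assume C: "compact C"
  then obtain B where B: "\<And>z. z \<in> C \<Longrightarrow> norm z \<le> B"
    by (meson bounded_iff compact_imp_bounded)
  let ?K = "{- \<lceil>(B + pi) / (2 * pi)\<rceil>..\<lceil>(B + pi) / (2 * pi)\<rceil>}"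
  have "k \<in> ?K" if "?f (t, k) \<in> C" for t k
  proof -
    have "\<bar>2 * pi * of_int k - angle (\<gamma> t)\<bar> \<le> B"
      using B[OF that] norm_snd_le[of "2 * pi * of_int k - angle (\<gamma> t)" "norm (\<gamma> t)"] by simp
    then have "\<bar>2 * pi * of_int k\<bar> \<le> B + pi"
      using angle_bounded[of "\<gamma> t"] by linarith
    then have "\<bar>of_int k\<bar> \<le> (B + pi) / (2 * pi)"
      by (simp add: abs_mult field_simps)
    then have "\<bar>k\<bar> \<le> \<lceil>(B + pi) / (2 * pi)\<rceil>"
      by linarith
    then show ?thesis
      by auto
  qed
  then have sub: "?f -` C \<inter> space (?M \<Otimes>\<^sub>M ?N) \<subseteq> {0..L} \<times> ?K"
    by (auto simp: space_pair_measure space_restrict_space)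
  have "emeasure (curve_kernel L \<gamma>) C = emeasure (?M \<Otimes>\<^sub>M ?N) (?f -` C \<inter> space (?M \<Otimes>\<^sub>M ?N))"
    unfolding curve_kernel_def using C by (intro emeasure_distr f) (auto intro: borel_compact)
  also have "\<dots> \<le> emeasure (?M \<Otimes>\<^sub>M ?N) ({0..L} \<times> ?K)"
    by (rule emeasure_mono[OF sub]) (auto intro!: pair_measureI simp: sets_restrict_space_iff)
  also have "\<dots> = emeasure ?M {0..L} * emeasure ?N ?K"
    by (rule N.emeasure_pair_measure_Times) (auto simp: sets_restrict_space_iff)
  also have "\<dots> < \<infinity>"
    by (auto simp: emeasure_restrict_space ennreal_mult_less_top emeasure_lborel_Icc_eq of_nat_less_top)
  finally show "emeasure (curve_kernel L \<gamma>) C < \<infinity>" .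
qed

text \<open>
  Integration over the graph of \<open>j\<close> reduces to integration over its domain by Fubini's theorem:
  each fiber carries a single point of mass one.
\<close>

lemma integral_graph_count_space:
  fixes g :: "'a \<Rightarrow> real" and j :: "'a \<Rightarrow> int"
  assumes M: "sigma_finite_measure M" and [measurable]: "j \<in> M \<rightarrow>\<^sub>M count_space UNIV"
    and g: "integrable M g"
  shows "integrable (M \<Otimes>\<^sub>M count_space UNIV) (\<lambda>(t, k). if k = j t then g t else 0)" (is "integrable _ ?G")
    and "integral\<^sup>L (M \<Otimes>\<^sub>M count_space UNIV) (\<lambda>(t, k). if k = j t then g t else 0) = integral\<^sup>L M g"
proof -
  interpret M: sigma_finite_measure M by fact
  interpret N: sigma_finite_measure "count_space UNIV :: int measure"
    by (rule sigma_finite_measure_count_space)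
  interpret pair_sigma_finite M "count_space UNIV :: int measure" ..
  have [measurable]: "g \<in> borel_measurable M"
    using g by auto
  have fiber: "integrable (count_space UNIV) (\<lambda>k. if k = i then c else 0)"
    "integral\<^sup>L (count_space UNIV) (\<lambda>k. if k = i then c else 0) = c" for i :: int and c :: real
  proof -
    have eq: "(\<lambda>k. if k = i then c else 0) = (\<lambda>k. indicator {i} k *\<^sub>R c)"
      by (auto simp: indicator_def)
    show "integrable (count_space UNIV) (\<lambda>k. if k = i then c else 0)"
      "integral\<^sup>L (count_space UNIV) (\<lambda>k. if k = i then c else 0) = c"
      unfolding eq by simp_all
  qed
  have norm: "norm (if b then c else 0) = (if b then \<bar>c\<bar> else 0)" for b and c :: real
    by simp
  show int: "integrable (M \<Otimes>\<^sub>M count_space UNIV) ?G"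
    by (rule Fubini_integrable) (use g in \<open>simp_all add: norm fiber del: real_norm_def\<close>)
  from integral_fst[OF int]
  show "integral\<^sup>L (M \<Otimes>\<^sub>M count_space UNIV) ?G = integral\<^sup>L M g"
    by (simp add: fiber)
qed

lemma sheet_unique:
  fixes \<theta> :: real and k :: int
  shows "\<theta> - 2 * pi * of_int k \<in> {0..<2 * pi} \<longleftrightarrow> k = \<lfloor>\<theta> / (2 * pi)\<rfloor>"
proof -
  have "\<theta> - 2 * pi * of_int k \<in> {0..<2 * pi} \<longleftrightarrow> of_int k \<le> \<theta> / (2 * pi) \<and> \<theta> / (2 * pi) < of_int k + 1"
    by (auto simp: field_simps)
  also have "\<dots> \<longleftrightarrow> k = \<lfloor>\<theta> / (2 * pi)\<rfloor>"
    by linarith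
  finally show ?thesis .
qed

text \<open>
  The shifted kernel sees the curve rotated by \<open>s\<close> in polar coordinates, and the window
  \<open>0 \<le> \<theta> < 2\<pi>\<close> selects exactly one period for each curve point.
\<close>

lemma curve_kernel_integral:
  fixes f :: "real ^ 2 \<Rightarrow> real"
  assumes \<gamma>: "continuous_on {0..L} \<gamma>" and range: "\<gamma> ` {0..L} \<subseteq> cball 0 1"
    and f: "f \<in> borel_measurable (restrict_space borel (cball 0 1))"
    and int: "arclength_integrable L (\<lambda>t. rotation s (\<gamma> t)) f"
  shows "kernel_integrable (shift_kernel s (curve_kernel L \<gamma>)) f"
    and "kernel_integral (shift_kernel s (curve_kernel L \<gamma>)) f =
      arclength_integral L (\<lambda>t. rotation s (\<gamma> t)) f"
proof -
  let ?M = "restrict_space lborel {0..L} :: real measure"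
  let ?N = "count_space UNIV :: int measure"
  let ?g = "\<lambda>t. f (rotation s (\<gamma> t))"
  let ?j = "\<lambda>t. \<lfloor>(s + angle (\<gamma> t)) / (2 * pi)\<rfloor>"
  let ?p = "\<lambda>(t, k :: int). (norm (\<gamma> t), s + angle (\<gamma> t) - 2 * pi * of_int k)"
  let ?F = "\<lambda>z. indicator ({0..1} \<times> {0..<2 * pi}) z *\<^sub>R (case z of (\<rho>, \<theta>) \<Rightarrow> f (polar \<rho> \<theta>))"
  note [measurable] = measurable_curve[OF \<gamma>]
  have g: "integrable ?M ?g" "integral\<^sup>L ?M ?g = arclength_integral L (\<lambda>t. rotation s (\<gamma> t)) f"
    using int by (simp_all add: arclength_integrable_def arclength_integral_def set_integrable_def
        set_lebesgue_integral_def integrable_restrict_space integral_restrict_space)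
  have p: "?p \<in> ?M \<Otimes>\<^sub>M ?N \<rightarrow>\<^sub>M borel"
    unfolding borel_prod[symmetric] by measurable
  have refl: "(\<lambda>(\<rho>, \<phi>). (\<rho>, s - \<phi>)) \<in> (borel :: (real \<times> real) measure) \<rightarrow>\<^sub>M borel"
    unfolding borel_prod[symmetric] by measurable
  have K: "shift_kernel s (curve_kernel L \<gamma>) = distr (?M \<Otimes>\<^sub>M ?N) borel ?p"
  proof -
    have "shift_kernel s (curve_kernel L \<gamma>) = distr (?M \<Otimes>\<^sub>M ?N) borel ((\<lambda>(\<rho>, \<phi>). (\<rho>, s - \<phi>)) \<circ>
        (\<lambda>(t, k :: int). (norm (\<gamma> t), 2 * pi * of_int k - angle (\<gamma> t))))"
      unfolding shift_kernel_def curve_kernel_def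
      by (rule distr_distr[OF refl measurable_curve_kernel_map[OF \<gamma>]])
    also have "(\<lambda>(\<rho>, \<phi>). (\<rho>, s - \<phi>)) \<circ> (\<lambda>(t, k :: int). (norm (\<gamma> t), 2 * pi * of_int k - angle (\<gamma> t))) = ?p"
      by (auto simp: fun_eq_iff)
    finally show ?thesis .
  qed
  have F: "?F \<in> borel_measurable borel"
  proof -
    (* f is measurable only on the disk, so it is cut off there; the window has rho in [0, 1]. *)
    have [measurable]: "(\<lambda>x. indicator (cball 0 1) x *\<^sub>R f x) \<in> borel_measurable borel"
      using f by (simp add: borel_measurable_restrict_space_iff)
    have [measurable]: "{0..1} \<times> {0..<2 * pi} \<in> sets (borel :: (real \<times> real) measure)"
      unfolding borel_prod[symmetric] by (intro pair_measureI) auto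
    have "?F = (\<lambda>z. indicator ({0..1} \<times> {0..<2 * pi}) z *\<^sub>R
        (indicator (cball 0 1) (polar (fst z) (snd z)) *\<^sub>R f (polar (fst z) (snd z))))"
      by (auto simp: fun_eq_iff indicator_def norm_polar)
    also have "\<dots> \<in> borel_measurable borel"
      by measurable
    finally show ?thesis .
  qed
  have Fp: "?F (?p (t, k)) = (if k = ?j t then ?g t else 0)" if "t \<in> {0..L}" for t k
  proof -
    have "rotation s (\<gamma> t) = rotation s (polar (norm (\<gamma> t)) (angle (\<gamma> t)))"
      by (simp only: polar_angle)
    then have "?g t = f (polar (norm (\<gamma> t)) (s + angle (\<gamma> t) - 2 * pi * of_int k))"
      by (simp only: rotation_polar polar_minus_period)
    moreover have "norm (\<gamma> t) \<in> {0..1}"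
      using that range by (auto simp: image_subset_iff)
    ultimately show ?thesis
      using sheet_unique[of "s + angle (\<gamma> t)" k] by (auto simp: indicator_def)
  qed
  have "integrable (?M \<Otimes>\<^sub>M ?N) (\<lambda>(t, k). if k = ?j t then ?g t else 0)"
    and eq: "integral\<^sup>L (?M \<Otimes>\<^sub>M ?N) (\<lambda>(t, k). if k = ?j t then ?g t else 0) = integral\<^sup>L ?M ?g"
    by (intro integral_graph_count_space sigma_finite_restrict_lborel g; measurable)+
  moreover have "integrable (?M \<Otimes>\<^sub>M ?N) (\<lambda>z. ?F (?p z)) \<longleftrightarrow>
      integrable (?M \<Otimes>\<^sub>M ?N) (\<lambda>(t, k). if k = ?j t then ?g t else 0)"
    by (rule Bochner_Integration.integrable_cong)
      (use Fp in \<open>auto simp: space_pair_measure space_restrict_space\<close>)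
  ultimately show "kernel_integrable (shift_kernel s (curve_kernel L \<gamma>)) f"
    unfolding kernel_integrable_def set_integrable_def K integrable_distr_eq[OF p F] by simp
  have "integral\<^sup>L (?M \<Otimes>\<^sub>M ?N) (\<lambda>z. ?F (?p z)) =
      integral\<^sup>L (?M \<Otimes>\<^sub>M ?N) (\<lambda>(t, k). if k = ?j t then ?g t else 0)"
    by (rule Bochner_Integration.integral_cong)
      (use Fp in \<open>auto simp: space_pair_measure space_restrict_space\<close>)
  then show "kernel_integral (shift_kernel s (curve_kernel L \<gamma>)) f =
      arclength_integral L (\<lambda>t. rotation s (\<gamma> t)) f"
    unfolding kernel_integral_def set_lebesgue_integral_def K integral_distr[OF p F] eq g by simp
qed

section \<open>Translation invariance of the traveltime kernel\<close>

theorem proposition1: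
  fixes m0 :: "real ^ 2 \<Rightarrow> real"
    and u :: "real ^ 2 \<Rightarrow> real ^ 2 \<Rightarrow> real"
    and len :: "real ^ 2 \<Rightarrow> real ^ 2 \<Rightarrow> real"
    and C :: "real ^ 2 \<Rightarrow> real ^ 2 \<Rightarrow> real \<Rightarrow> real ^ 2"
  assumes pos: "\<And>x. x \<in> ball 0 1 \<Longrightarrow> m0 x > 0"
    and radial: "\<And>x y. x \<in> ball 0 1 \<Longrightarrow> y \<in> ball 0 1 \<Longrightarrow> norm x = norm y \<Longrightarrow> m0 x = m0 y"
    and background: "\<And>s. first_arrival m0 (bdpt s) (u (bdpt s))"
    and charac: "\<And>s r. unique_characteristic (u (bdpt s)) (bdpt s) (bdpt r)
                         (len (bdpt s) (bdpt r)) (C (bdpt s) (bdpt r))"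
  shows "\<exists>\<kappa> :: real \<Rightarrow> (real \<times> real) measure.
           (\<forall>h. periodic_kernel (\<kappa> h)) \<and>
           (\<forall>(mt :: real ^ 2 \<Rightarrow> real) s h.
              mt \<in> borel_measurable (restrict_space borel (cball 0 1)) \<longrightarrow>
              arclength_integrable (len (bdpt s) (bdpt (s + h))) (C (bdpt s) (bdpt (s + h))) mt \<longrightarrow>
              kernel_integrable (shift_kernel s (\<kappa> h)) mt \<and>
              arclength_integral (len (bdpt s) (bdpt (s + h))) (C (bdpt s) (bdpt (s + h))) mt
                = kernel_integral (shift_kernel s (\<kappa> h)) mt)"
proof -
  define L where "L h = len (bdpt 0) (bdpt h)" for h
  define \<gamma> where "\<gamma> h = C (bdpt 0) (bdpt h)" for h
  have \<gamma>: "characteristic (u (bdpt 0)) (bdpt 0) (bdpt h) (L h) (\<gamma> h)" for h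
    using charac[of 0 h] by (simp add: unique_characteristic_def L_def \<gamma>_def)
  have cont: "continuous_on {0..L h} (\<gamma> h)" and range: "\<gamma> h ` {0..L h} \<subseteq> cball 0 1" for h
    using \<gamma>[of h] by (auto simp: characteristic_def)
  have len: "len (bdpt s) (bdpt (s + h)) = L h"
    and C: "\<And>t. t \<in> {0..L h} \<Longrightarrow> C (bdpt s) (bdpt (s + h)) t = rotation s (\<gamma> h t)" for s h
  proof -
    note T = orthogonal_transformation_rotation[of s]
    have "u (bdpt s) (rotation s x) = u (bdpt 0) x" if x: "x \<in> cball 0 1" for x
    proof -
      have "first_arrival m0 (bdpt 0) (\<lambda>x. u (bdpt s) (rotation s x))"
        using background[of s] T
        by (intro first_arrival_compose_orthogonal[OF T] radial)
          (simp_all add: rotation_bdpt orthogonal_transformation_norm)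
      then show ?thesis
        using background x by (rule first_arrival_unique)
    qed
    from characteristic_image_orthogonal[OF T this \<gamma>]
    have "characteristic (u (bdpt s)) (bdpt s) (bdpt (s + h)) (L h) (\<lambda>t. rotation s (\<gamma> h t))"
      by (simp add: rotation_bdpt)
    with charac[of s "s + h"]
    have "L h = len (bdpt s) (bdpt (s + h)) \<and>
        (\<forall>t \<in> {0..len (bdpt s) (bdpt (s + h))}. rotation s (\<gamma> h t) = C (bdpt s) (bdpt (s + h)) t)"
      unfolding unique_characteristic_def by blast
    then show "len (bdpt s) (bdpt (s + h)) = L h"
      "\<And>t. t \<in> {0..L h} \<Longrightarrow> C (bdpt s) (bdpt (s + h)) t = rotation s (\<gamma> h t)"
      by auto
  qed
  show ?thesis
  proof (intro exI[of _ "\<lambda>h. curve_kernel (L h) (\<gamma> h)"] conjI allI impI)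
    show "periodic_kernel (curve_kernel (L h) (\<gamma> h))" for h
      using cont range by (rule periodic_kernel_curve_kernel)
    fix mt :: "real ^ 2 \<Rightarrow> real" and s h
    let ?L = "len (bdpt s) (bdpt (s + h))" and ?C = "C (bdpt s) (bdpt (s + h))"
    have int_iff: "arclength_integrable ?L ?C mt \<longleftrightarrow>
        arclength_integrable (L h) (\<lambda>t. rotation s (\<gamma> h t)) mt"
      unfolding arclength_integrable_def len by (rule set_integrable_cong) (simp_all add: C)
    have int_eq: "arclength_integral ?L ?C mt =
        arclength_integral (L h) (\<lambda>t. rotation s (\<gamma> h t)) mt"
      unfolding arclength_integral_def len by (rule set_lebesgue_integral_cong) (simp_all add: C)
    assume mt: "mt \<in> borel_measurable (restrict_space borel (cball 0 1))"
      and "arclength_integrable ?L ?C mt"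
    with int_iff have int: "arclength_integrable (L h) (\<lambda>t. rotation s (\<gamma> h t)) mt"
      by simp
    show "kernel_integrable (shift_kernel s (curve_kernel (L h) (\<gamma> h))) mt"
      by (rule curve_kernel_integral[OF cont range mt int])
    show "arclength_integral ?L ?C mt =
        kernel_integral (shift_kernel s (curve_kernel (L h) (\<gamma> h))) mt"
      unfolding int_eq by (rule curve_kernel_integral(2)[OF cont range mt int, symmetric])
  qed
qed

end
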